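(* Let $\mathfrak A\in K_{\overline\alpha}$ with $\delta(\mathfrak A)>0$. (1) If $\overline\alpha$ is not rational, then for every $\epsilon>0$ there are infinitely many pairwise non-isomorphic $\mathfrak D\in K_{\overline\alpha}$ such that $(\mathfrak A,\mathfrak D)$ is an essential minimal pair with $-\epsilon<\delta(\mathfrak D/\mathfrak A)<0$. (2) If $\overline\alpha$ is rational, then there are infinitely many pairwise non-isomorphic $\mathfrak D\in K_{\overline\alpha}$ such that $(\mathfrak A,\mathfrak D)$ is an essential minimal pair with $\delta(\mathfrak D/\mathfrak A)=-1/c$.
   Context: Fix a finite relational language $L$ in which every relation symbol has arity at least $2$. $K_L$ is the class of all finite $L$-structures (including the empty one) in which every relation symbol is interpreted symmetrically and irreflexively. Fix $\overline\alpha:L\to(0,1]$, writing $\overline\alpha_E=\overline\alpha(E)$, such that it is not the case that all symbols of $L$ are binary and $\overline\alpha_E=1$ for all $E$. For $\mathfrak A\in K_L$ let $N_E(\mathfrak A)$ be the number of subsets of $A$ on which $E$ holds and $\delta(\mathfrak A)=|A|-\sum_{E}\overline\alpha_E N_E(\mathfrak A)$. $K_{\overline\alpha}=\{\mathfrak A\in K_L:\delta(\mathfrak A')\ge0\text{ for all substructures }\mathfrak A'\subseteq\mathfrak A\}$. Subsets are identified with induced substructures; for $\mathfrak A\subseteq \mathfrak D$, $\delta(\mathfrak D/\mathfrak A)=\delta(\mathfrak D)-\delta(\mathfrak A)$, and for substructures $X,Y$ of a structure, $\delta(X/Y)=\delta(X\cup Y)-\delta(Y)$. For $\mathfrak A\subseteq\mathfrak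 B$, $\mathfrak A\le\mathfrak B$ means $\delta(\mathfrak A)\le\delta(\mathfrak A')$ for all $\mathfrak A\subseteq\mathfrak A'\subseteq\mathfrak B$; $(\mathfrak A,\mathfrak B)$ is a minimal pair if $\mathfrak A\subseteq\mathfrak B$, $\mathfrak A\le\mathfrak C$ for all $\mathfrak A\subseteq\mathfrak C\subsetneq\mathfrak B$, but $\mathfrak A\not\le\mathfrak B$. For $\mathfrak B\in K_{\overline\alpha}$ with $\delta(\mathfrak B)>0$, a structure $\mathfrak D\in K_{\overline\alpha}$ with $\mathfrak B\subseteq\mathfrak D$ forms an essential minimal pair $(\mathfrak B,\mathfrak D)$ if $(\mathfrak B,\mathfrak D)$ is a minimal pair and $\delta(\mathfrak D'/\mathfrak D'\cap\mathfrak B)\ge0$ for every substructure $\mathfrak D'\subsetneq\mathfrak D$. $\overline\alpha$ is rational if each $\overline\alpha_E$ is rational; in that case write $\overline\alpha_E=p_E/q_E$ in lowest terms and $c=\mathrm{lcm}\{q_E:E\in L\}$. *)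

theory Defs
  imports Complex_Main
begin

text \<open>A structure is a pair (universe, interpretation). Since every relation symbol is
interpreted symmetrically and irreflexively, the interpretation of a symbol E of
arity ar E is identified with the set of (ar E)-element subsets of the universe on
which E holds.\<close>

type_synonym ('a, 'l) struc = "'a set \<times> ('l \<Rightarrow> 'a set set)"

definition wf_struc :: "'l set \<Rightarrow> ('l \<Rightarrow> nat) \<Rightarrow> ('a, 'l) struc \<Rightarrow> bool" where
  "wf_struc L ar D \<longleftrightarrow> finite (fst D) \<and>
     (\<forall>E. E \<in> L \<longrightarrow> snd D E \<subseteq> {S. S \<subseteq> fst D \<and> card S = ar E}) \<and>
     (\<forall>E. E \<notin> L \<longrightarrow> snd D E = {})"

definition induced :: "('a, 'l) struc \<Rightarrow> 'a set \<Rightarrow> ('a, 'l) struc" where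
  "induced D X = (X, \<lambda>E. {S \<in> snd D E. S \<subseteq> X})"

definition substr :: "('a, 'l) struc \<Rightarrow> ('a, 'l) struc \<Rightarrow> bool" where
  "substr A D \<longleftrightarrow> fst A \<subseteq> fst D \<and> A = induced D (fst A)"

definition delta :: "'l set \<Rightarrow> ('l \<Rightarrow> real) \<Rightarrow> ('a, 'l) struc \<Rightarrow> real" where
  "delta L alpha D = real (card (fst D)) - (\<Sum>E\<in>L. alpha E * real (card (snd D E)))"

definition K_alpha :: "'l set \<Rightarrow> ('l \<Rightarrow> nat) \<Rightarrow> ('l \<Rightarrow> real) \<Rightarrow> ('a, 'l) struc \<Rightarrow> bool" where
  "K_alpha L ar alpha D \<longleftrightarrow> wf_struc L ar D \<and>
     (\<forall>X. X \<subseteq> fst D \<longrightarrow> delta L alpha (induced D X) \<ge> 0)"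

definition le_str :: "'l set \<Rightarrow> ('l \<Rightarrow> real) \<Rightarrow> ('a, 'l) struc \<Rightarrow> ('a, 'l) struc \<Rightarrow> bool" where
  "le_str L alpha A B \<longleftrightarrow> substr A B \<and>
     (\<forall>X. fst A \<subseteq> X \<and> X \<subseteq> fst B \<longrightarrow> delta L alpha A \<le> delta L alpha (induced B X))"

definition minimal_pair :: "'l set \<Rightarrow> ('l \<Rightarrow> real) \<Rightarrow> ('a, 'l) struc \<Rightarrow> ('a, 'l) struc \<Rightarrow> bool" where
  "minimal_pair L alpha A B \<longleftrightarrow> substr A B \<and>
     (\<forall>X. fst A \<subseteq> X \<and> X \<subset> fst B \<longrightarrow> le_str L alpha A (induced B X)) \<and>
     \<not> le_str L alpha A B"

definition essential_minimal_pair ::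
  "'l set \<Rightarrow> ('l \<Rightarrow> nat) \<Rightarrow> ('l \<Rightarrow> real) \<Rightarrow> ('a, 'l) struc \<Rightarrow> ('a, 'l) struc \<Rightarrow> bool" where
  "essential_minimal_pair L ar alpha B D \<longleftrightarrow>
     K_alpha L ar alpha B \<and> delta L alpha B > 0 \<and> K_alpha L ar alpha D \<and>
     minimal_pair L alpha B D \<and>
     (\<forall>X. X \<subset> fst D \<longrightarrow>
        delta L alpha (induced D X) - delta L alpha (induced D (X \<inter> fst B)) \<ge> 0)"

definition isomorphic :: "'l set \<Rightarrow> ('a, 'l) struc \<Rightarrow> ('a, 'l) struc \<Rightarrow> bool" where
  "isomorphic L D1 D2 \<longleftrightarrow> (\<exists>f. bij_betw f (fst D1) (fst D2) \<and>
     (\<forall>E\<in>L. snd D2 E = (\<lambda>S. f ` S) ` snd D1 E))"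

definition rational_weights :: "'l set \<Rightarrow> ('l \<Rightarrow> real) \<Rightarrow> bool" where
  "rational_weights L alpha \<longleftrightarrow> (\<forall>E\<in>L. alpha E \<in> \<rat>)"

definition real_denom :: "real \<Rightarrow> int" where
  "real_denom x = snd (quotient_of (THE r. of_rat r = x))"

definition lcm_denoms :: "'l set \<Rightarrow> ('l \<Rightarrow> real) \<Rightarrow> int" where
  "lcm_denoms L alpha = Lcm ((\<lambda>E. real_denom (alpha E)) ` L)"

end

theory Submission
  imports Defs "HOL-Analysis.Kronecker_Approximation_Theorem"
begin

text \<open>
  Adjoin to \<open>A\<close> new points \<open>b\<^sub>0, \<dots>, b\<^sub>n\<^sub>-\<^sub>1\<close> and new edges whose weights add up to \<open>n + \<eta>\<close>. Lay the edges
  end to end as intervals tiling \<open>[-\<eta>, n]\<close>, where \<open>b\<^sub>i\<close> occupies the cell \<open>[i, i + 1]\<close> and \<open>b\<^sub>0\<close> also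
  \<open>[-\<eta>, 0]\<close>; an edge contains every point whose cell it overlaps and shares its weight among those
  points according to the length of the overlap. Then each point carries load 1, except that \<open>b\<^sub>0\<close>
  carries \<open>1 + \<eta>\<close>. If \<open>X\<close> is a proper subset containing \<open>b\<^sub>0\<close>, some edge leaves \<open>X\<close> while placing
  at least \<open>\<eta>\<close> on a point of \<open>X\<close>: the edge across the first cell boundary that leaves \<open>X\<close>, or an
  edge through a point of \<open>A\<close> outside \<open>X\<close>. So the edges inside \<open>X\<close> weigh at most the number of new
  points in \<open>X\<close>, which is the essential minimality of the pair, while in total \<open>\<delta>(D/A) = -\<eta>\<close>.

  This needs that no edge overlaps the cell to the left of a boundary by less than \<open>\<eta>\<close>. For rational
  weights all interval ends lie in \<open>(1/c)\<int>\<close> and \<open>\<eta> = 1/c\<close> is attained by Bezout's identity. Otherwise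
  one irrational weight \<open>x\<close> is used, with \<open>\<eta> = frac (m x)\<close> a record minimum among the multiples of \<open>x\<close>.
\<close>

section \<open>Tiling a line by edge weights\<close>

text \<open>Here \<open>m\<close> counts the new edges, \<open>n\<close> the new points, \<eta> is
  the excess of the total weight over \<open>n\<close>, and \<omega> bounds the weights from below.
  In terms of \<open>start\<close>, the assumption \<open>gap\<close> says that no edge starts
  strictly between \<open>i - \<eta>\<close> and a cell boundary \<open>i\<close>.\<close>

locale weight_line =
  fixes w :: "nat \<Rightarrow> real" and m n :: nat and \<eta> \<omega> :: real
  assumes eta_pos: "0 < \<eta>" and eta_le: "\<eta> \<le> \<omega>"
    and w_ge: "j < m \<Longrightarrow> \<omega> \<le> w j" and w_le: "j < m \<Longrightarrow> w j \<le> 1"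
    and total: "(\<Sum>j<m. w j) = real n + \<eta>"
    and gap: "j < m \<Longrightarrow> 1 \<le> i \<Longrightarrow> real i < (\<Sum>k<j. w k) \<Longrightarrow> real i + \<eta> \<le> (\<Sum>k<j. w k)"
    and n_pos: "0 < n"
begin

definition start :: "nat \<Rightarrow> real" where
  "start j = (\<Sum>k<j. w k) - \<eta>"

text \<open>\<open>nat\<close> sends the negative starts in [-\<eta>, 0) to 0, which merges this
  initial piece with cell 0.\<close>

definition cell :: "nat \<Rightarrow> nat" where
  "cell j = nat \<lfloor>start j\<rfloor>"

text \<open>The inequality is not strict: an edge ending exactly at the boundary counts as crossing,
  although its share in the next cell is 0. Thus every interior boundary has an edge that links the
  points on its two sides.\<close>

definition crossing :: "nat \<Rightarrow> bool" where
  "crossing j \<longleftrightarrow> real (cell j) + 1 \<le> start (Suc j)"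

definition cell_left :: "nat \<Rightarrow> real" where
  "cell_left i = (if i = 0 then - \<eta> else real i)"

definition clamp_cell :: "nat \<Rightarrow> real \<Rightarrow> real" where
  "clamp_cell i x = max (cell_left i) (min x (real i + 1))"

text \<open>The overlap of edge \<open>j\<close> with cell \<open>i\<close>, written as a difference
  of clamped end points so that sums over \<open>j\<close> telescope.\<close>

definition share :: "nat \<Rightarrow> nat \<Rightarrow> real" where
  "share j i = clamp_cell i (start (Suc j)) - clamp_cell i (start j)"

lemma start_0: "start 0 = - \<eta>"
  and start_Suc: "start (Suc j) = start j + w j"
  and start_m: "start m = real n"
  using total by (simp_all add: start_def)

lemma start_add: "j + k \<le> m \<Longrightarrow> start j + real k * \<omega> \<le> start (j + k)"
proof (induction k)
  case (Suc k)
  then show ?case using w_ge[of "j + k"] by (simp add: start_Suc algebra_simps)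
qed simp

lemma start_mono: "j \<le> k \<Longrightarrow> k \<le> m \<Longrightarrow> start j \<le> start k"
  using start_add[of j "k - j"] eta_pos eta_le
  by (smt (verit) le_add_diff_inverse mult_nonneg_nonneg of_nat_0_le_iff)

lemma start_ge: "j \<le> m \<Longrightarrow> - \<eta> \<le> start j"
  using start_mono[of 0 j] by (simp add: start_0)

lemma start_less: "j < m \<Longrightarrow> start j < real n"
  using start_mono[of "Suc j" m] w_ge[of j] eta_pos eta_le by (simp add: start_Suc start_m)

lemma m_pos: "0 < m"
  using total eta_pos by (cases m) auto

lemma eta_le_1: "\<eta> \<le> 1"
  using eta_le w_ge[OF m_pos] w_le[OF m_pos] by linarith

lemma cell_bounds:
  assumes "j < m"
  shows "cell_left (cell j) \<le> start j" and "start j < real (cell j) + 1"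
proof -
  have "start j \<ge> - \<eta>" using start_ge assms by simp
  then show "cell_left (cell j) \<le> start j"
    unfolding cell_left_def cell_def by (auto simp: not_le)
  show "start j < real (cell j) + 1"
    unfolding cell_def by linarith
qed

lemma cell_less: "j < m \<Longrightarrow> cell j < n"
  using start_less[of j] n_pos unfolding cell_def by linarith

lemma share_nonneg: "j < m \<Longrightarrow> 0 \<le> share j i"
  using w_ge[of j] eta_pos eta_le
  by (auto simp: share_def clamp_cell_def start_Suc max_def min_def)

lemma sum_clamp: "- \<eta> \<le> x \<Longrightarrow> (\<Sum>i<Suc k. clamp_cell i x - cell_left i) = min x (real (Suc k)) + \<eta>"
proof (induction k)
  case 0
  then show ?case using eta_pos by (auto simp: clamp_cell_def cell_left_def)
next
  case (Suc k)
  have "clamp_cell (Suc k) x - cell_left (Suc k) = min x (real (Suc (Suc k))) - min x (real (Suc k))"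
    by (auto simp: clamp_cell_def cell_left_def max_def min_def)
  with Suc show ?case by (simp del: of_nat_Suc)
qed

lemma sum_share_cells:
  assumes "j < m" shows "(\<Sum>i<n. share j i) = w j"
proof -
  obtain k where n: "n = Suc k" using n_pos by (cases n) auto
  have "(\<Sum>i<n. share j i) = (\<Sum>i<n. clamp_cell i (start (Suc j)) - cell_left i)
      - (\<Sum>i<n. clamp_cell i (start j) - cell_left i)"
    by (simp add: share_def sum_subtractf)
  also have "\<dots> = min (start (Suc j)) (real n) - min (start j) (real n)"
    unfolding n using assms start_ge[of j] start_ge[of "Suc j"] by (simp add: sum_clamp del: sum.lessThan_Suc)
  also have "\<dots> = w j"
    using start_mono[of "Suc j" m] start_less[of j] assms by (simp add: start_m start_Suc)
  finally show ?thesis .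
qed

lemma sum_share_edges:
  assumes "i < n" shows "(\<Sum>j<m. share j i) = 1 + (if i = 0 then \<eta> else 0)"
proof -
  have "(\<Sum>j<m. share j i) = clamp_cell i (start m) - clamp_cell i (start 0)"
    unfolding share_def by (rule sum_lessThan_telescope)
  also have "\<dots> = 1 + (if i = 0 then \<eta> else 0)"
    using assms eta_pos by (auto simp: start_m start_0 clamp_cell_def cell_left_def)
  finally show ?thesis .
qed

text \<open>Weights are at most 1, so an edge starting before the end of its cell ends before the
  end of the next one.\<close>

lemma share_support:
  assumes "j < m" "share j i \<noteq> 0"
  shows "i = cell j \<or> crossing j \<and> i = Suc (cell j)"
proof (rule ccontr)
  assume *: "\<not> ?thesis"
  have end_le: "start j \<le> start (Suc j)" "start (Suc j) \<le> start j + 1"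
    using w_ge[of j] w_le[of j] assms(1) eta_pos eta_le by (auto simp: start_Suc)
  note rb = cell_bounds[OF assms(1)]
  consider "i < cell j" | "i = Suc (cell j)" "\<not> crossing j" | "Suc (cell j) < i"
    using * by force
  then have "share j i = 0"
  proof cases
    case 1
    then have "real i + 1 \<le> start j" using rb by (auto simp: cell_left_def)
    then show ?thesis using end_le by (auto simp: share_def clamp_cell_def)
  next
    case 2
    then show ?thesis using end_le rb by (auto simp: share_def clamp_cell_def crossing_def cell_left_def)
  next
    case 3
    then have "start (Suc j) < real i" using end_le rb by linarith
    then show ?thesis using end_le 3 by (auto simp: share_def clamp_cell_def cell_left_def)
  qed
  with assms show False by simp
qed

text \<open>An edge that stays in its cell contributes its whole weight, at least \<omega>; one that
  leaves it starts at distance at least \<eta> from the boundary by \<open>gap\<close>.\<close>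

lemma share_cell_ge:
  assumes "j < m" shows "\<eta> \<le> share j (cell j)"
proof -
  note rb = cell_bounds[OF assms]
  have wj: "\<eta> \<le> w j" using w_ge[OF assms] eta_le by linarith
  have eq: "share j (cell j) = min (start (Suc j)) (real (cell j) + 1) - start j"
    using rb wj eta_pos by (auto simp: share_def clamp_cell_def start_Suc max_def min_def)
  have "\<eta> \<le> real (cell j) + 1 - start j"
    using gap[OF assms, of "Suc (cell j)"] rb by (fastforce simp: start_def)
  then show ?thesis unfolding eq using wj by (auto simp: start_Suc)
qed

text \<open>The last edge starting before the boundary \<open>i\<close> has length at most 1, so it
  starts in cell \<open>i - 1\<close>.\<close>

lemma ex_crossing:
  assumes "0 < i" "i < n"
  shows "\<exists>j<m. crossing j \<and> Suc (cell j) = i"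
proof -
  have "\<exists>k<m. (\<forall>j\<le>k. \<not> real i \<le> start j) \<and> real i \<le> start (Suc k)"
    by (rule ex_least_nat_less) (use assms eta_pos in \<open>auto simp: start_0 start_m\<close>)
  then obtain k where k: "k < m" "start k < real i" "real i \<le> start (Suc k)"
    by (auto simp: not_le)
  have "real i - 1 \<le> start k" using k w_le[of k] by (simp add: start_Suc)
  then have "\<lfloor>start k\<rfloor> = int i - 1" using k by (simp add: floor_eq_iff)
  then have "Suc (cell k) = i" using assms by (simp add: cell_def)
  then show ?thesis using k by (auto simp: crossing_def)
qed

lemma crossing_unique:
  assumes "j < m" "k < m" "crossing j" "crossing k" "cell j = cell k"
  shows "j = k"
proof -
  have "\<not> j < k" if "j < m" "k < m" "crossing j" "cell j = cell k" for j k
    using that cell_bounds[of k] start_mono[of "Suc j" k] by (auto simp: crossing_def)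
  then show ?thesis using assms by (metis nat_neq_iff)
qed

text \<open>Two starts in one cell differ by less than 1 + \<eta>, hence by less than 2. With
  \<open>K * \<omega>\<close> at least 2, residues modulo \<open>K\<close> therefore separate the
  edges of a cell.\<close>

lemma same_cell_close:
  assumes "j < m" "k < m" "cell j = cell k" "j \<le> k"
  shows "real (k - j) * \<omega> < 2"
proof -
  have "real (k - j) * \<omega> \<le> start k - start j" using start_add[of j "k - j"] assms by simp
  also have "\<dots> < 2"
    using cell_bounds[of j] cell_bounds[of k] assms eta_le_1
    by (auto simp: cell_left_def split: if_splits)
  finally show ?thesis .
qed

text \<open>Each of the \<open>n\<close> cells contains the start of at most one crossing
  edge.\<close>

lemma card_not_crossing: "m \<le> n + card {j. j < m \<and> \<not> crossing j}"
proof -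
  have "card {j. j < m \<and> crossing j} \<le> card {..<n}"
    by (rule card_inj_on_le[of cell]) (auto simp: inj_on_def crossing_unique cell_less)
  moreover have "{..<m} = {j. j < m \<and> crossing j} \<union> {j. j < m \<and> \<not> crossing j}" by auto
  then have "m \<le> card {j. j < m \<and> crossing j} + card {j. j < m \<and> \<not> crossing j}"
    by (metis card_Un_le card_lessThan)
  ultimately show ?thesis by simp
qed

section \<open>Weight of the edges inside a proper subset\<close>

text \<open>Double counting of shares: edges inside \<open>X\<close> load only new points of
  \<open>X\<close>, each with at most 1 apart from the excess \<eta> at \<open>b 0\<close>, and this
  excess is absorbed by what the edges leaving \<open>X\<close> place on points of
  \<open>X\<close>.\<close>

lemma weight_of_subset:
  fixes S :: "nat \<Rightarrow> 'a set" and b :: "nat \<Rightarrow> 'a" and A X :: "'a set"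
  assumes b: "inj_on b {..<n}"
    and S_cell: "\<And>j. j < m \<Longrightarrow> b (cell j) \<in> S j"
    and S_cross: "\<And>j. j < m \<Longrightarrow> crossing j \<Longrightarrow> Suc (cell j) < n \<Longrightarrow> b (Suc (cell j)) \<in> S j"
    and A: "A \<subseteq> (\<Union>j<m. S j)"
    and X: "X \<subset> A \<union> b ` {..<n}"
  shows "(\<Sum>j | j < m \<and> S j \<subseteq> X. w j) \<le> real (card (X \<inter> b ` {..<n}))"
proof -
  let ?J = "{j. j < m \<and> S j \<subseteq> X}" and ?I = "{i. i < n \<and> b i \<in> X}"
  have card: "card (X \<inter> b ` {..<n}) = card ?I"
  proof -
    have "X \<inter> b ` {..<n} = b ` ?I" by auto
    then show ?thesis using b by (auto intro!: card_image inj_on_subset[OF b])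
  qed
  have "(\<Sum>j\<in>?J. w j) = (\<Sum>j\<in>?J. \<Sum>i\<in>?I. share j i)"
  proof (rule sum.cong[OF refl])
    fix j assume j: "j \<in> ?J"
    have "share j i = 0" if "i < n" "b i \<notin> X" for i
      using share_support[of j i] S_cell[of j] S_cross[of j] j that by auto
    then have "(\<Sum>i\<in>?I. share j i) = (\<Sum>i<n. share j i)"
      by (intro sum.mono_neutral_left) auto
    then show "w j = (\<Sum>i\<in>?I. share j i)" using sum_share_cells j by simp
  qed
  also have "\<dots> = (\<Sum>i\<in>?I. \<Sum>j\<in>?J. share j i)" by (rule sum.swap)
  also have "\<dots> \<le> real (card ?I)"
  proof -
    \<comment> \<open>The load that \<open>b i\<close> receives from edges not contained in
      \<open>X\<close>.\<close>
    let ?miss = "\<lambda>i. \<Sum>j\<in>{..<m} - ?J. share j i"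
    have split: "(\<Sum>j\<in>?J. share j i) = 1 + (if i = 0 then \<eta> else 0) - ?miss i" if "i < n" for i
    proof -
      have "(\<Sum>j<m. share j i) = ?miss i + (\<Sum>j\<in>?J. share j i)"
        by (rule sum.subset_diff) auto
      then show ?thesis using sum_share_edges[OF that] by simp
    qed
    have miss0: "0 \<le> ?miss i" for i by (auto intro!: sum_nonneg share_nonneg)
    have "(\<Sum>i\<in>?I. \<Sum>j\<in>?J. share j i) = (\<Sum>i\<in>?I. 1 + (if i = 0 then \<eta> else 0) - ?miss i)"
      by (intro sum.cong) (auto simp: split)
    also have "\<dots> = real (card ?I) + (if 0 \<in> ?I then \<eta> else 0) - (\<Sum>i\<in>?I. ?miss i)"
      by (simp add: sum.distrib sum_subtractf)
    also have "(if 0 \<in> ?I then \<eta> else 0) \<le> (\<Sum>i\<in>?I. ?miss i)"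
    proof (cases "0 \<in> ?I")
      case True
      have "\<exists>j<m. b (cell j) \<in> X \<and> \<not> S j \<subseteq> X"
      proof (cases "\<exists>i<n. b i \<notin> X")
        case ex: True
        \<comment> \<open>For the first missing new point \<open>b i\<close>, its predecessor lies
          in \<open>X\<close>, and the edge crossing from cell \<open>i - 1\<close> contains
          both.\<close>
        define i where "i = (LEAST i. i < n \<and> b i \<notin> X)"
        have i: "i < n" "b i \<notin> X" using LeastI_ex[OF ex] by (auto simp: i_def)
        with True have "0 < i" by (cases i) auto
        then obtain j where j: "j < m" "crossing j" "Suc (cell j) = i" using ex_crossing i by blast
        then have "b (cell j) \<in> X"
          using not_less_Least[of "cell j" "\<lambda>i. i < n \<and> b i \<notin> X"] i by (auto simp: i_def[symmetric])
        then show ?thesis using j i S_cross[of j] by auto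
      next
        case False
        \<comment> \<open>All new points lie in \<open>X\<close>, so properness omits a point of
          \<open>A\<close>; any edge through it starts in the cell of a point of
          \<open>X\<close>.\<close>
        then obtain a where "a \<in> A" "a \<notin> X" using X by blast
        then show ?thesis using A False cell_less by blast
      qed
      then obtain j where j: "j < m" "b (cell j) \<in> X" "\<not> S j \<subseteq> X" by blast
      have "\<eta> \<le> share j (cell j)" using share_cell_ge j by simp
      also have "\<dots> \<le> ?miss (cell j)"
        using j by (intro member_le_sum) (auto intro: share_nonneg)
      also have "\<dots> \<le> (\<Sum>i\<in>?I. ?miss i)"
        using j cell_less by (intro member_le_sum) (auto intro: miss0)
      finally show ?thesis using True by simp
    qed (auto intro: sum_nonneg miss0)
    finally show ?thesis by simp
  qed
  finally show ?thesis by (simp add: card)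
qed


section \<open>Realising the intervals as distinct sets of points\<close>

text \<open>The tiling prescribes one point of a non-crossing edge and at most two of a crossing
  one. Hence \<open>free\<close> counts edges with room for a point of \<open>A\<close>.
  Distinctness ensures that the new structure counts all \<open>m\<close> edges.\<close>

lemma ex_distinct_edges:
  fixes b :: "nat \<Rightarrow> 'a" and A :: "'a set" and r :: "nat \<Rightarrow> nat" and K R :: nat
  assumes b: "inj_on b {..<n}" "b ` {..<n} \<inter> A = {}" and A: "finite A"
    and r: "\<And>j. j < m \<Longrightarrow> 2 \<le> r j \<and> r j \<le> R"
    and K: "2 \<le> real K * \<omega>" and n: "2 * (K + R) < n"
    and free: "card A \<le> card {j. j < m \<and> (\<not> crossing j \<or> 3 \<le> r j)}"
  obtains S where
    "\<And>j. j < m \<Longrightarrow> S j \<subseteq> A \<union> b ` {..<n}"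
    "\<And>j. j < m \<Longrightarrow> card (S j) = r j"
    "\<And>j. j < m \<Longrightarrow> b (cell j) \<in> S j"
    "\<And>j. j < m \<Longrightarrow> crossing j \<Longrightarrow> Suc (cell j) < n \<Longrightarrow> b (Suc (cell j)) \<in> S j"
    "inj_on S {..<m}"
    "A \<subseteq> (\<Union>j<m. S j)"
proof -
  \<comment> \<open>Edge \<open>j\<close> consists of \<open>b\<^sub>i\<close> for \<open>i = cell j\<close> and a run of consecutive points starting at \<open>b\<^sub>i\<^sub>+\<^sub>d\<close>,
    indices modulo \<open>n\<close>; as \<open>n\<close> is large, the set determines \<open>i\<close> and \<open>d\<close>. The offset is 1 for the edge
    leaving the cell; the others in the cell, fewer than \<open>K\<close> consecutive ones, are told apart by
    \<open>j mod K\<close>. Where the last point of the run is not needed, it may be traded for a point of \<open>A\<close>.\<close>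
  have K0: "0 < K" using K by (cases K) auto
  obtain \<phi> where \<phi>: "inj_on \<phi> A" "\<phi> ` A \<subseteq> {j. j < m \<and> (\<not> crossing j \<or> 3 \<le> r j)}"
    using card_le_inj[OF A _ free] by auto
  define d where "d j = (if crossing j then 1 else 2 + j mod K)" for j
  define pt where "pt j x = b ((cell j + x) mod n)" for j x
  define core where "core j = insert 0 {d j..<d j + (r j - 2)}" for j
  define S where "S j = (if j \<in> \<phi> ` A then insert (inv_into A \<phi> j) (pt j ` core j)
      else pt j ` insert (d j + (r j - 2)) (core j))" for j
  have d: "1 \<le> d j" "d j \<le> K + 1" for j
    using K0 by (auto simp: d_def Suc_le_eq)
  \<comment> \<open>Offsets stay below half of \<open>n\<close>, so that even a sum of two of them
    does not wrap around modulo \<open>n\<close>.\<close>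
  have bound: "x < n" "2 * x < n" if "j < m" "x \<in> insert (d j + (r j - 2)) (core j)" for j x
    using that d[of j] r[of j] n by (auto simp: core_def)
  have pt_B: "pt j x \<in> b ` {..<n}" for j x
    using n by (auto simp: pt_def)
  have pt_eq: "pt j x = pt k y \<longleftrightarrow> (cell j + x) mod n = (cell k + y) mod n" for j k x y
    using n by (auto simp: pt_def inj_on_eq_iff[OF b(1)])
  have pt_inj: "x = y" if "pt j x = pt j y" "x < n" "y < n" for j x y
  proof -
    have "x = y" if "x \<le> y" "y < n" "(cell j + x) mod n = (cell j + y) mod n" for x y
    proof -
      have "n dvd (cell j + y) - (cell j + x)" using that mod_eq_dvd_iff_nat[of "cell j + x" "cell j + y" n] by simp
      then show ?thesis using that nat_dvd_not_less[of "y - x" n] by (cases "x = y") auto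
    qed
    then show ?thesis using that by (metis pt_eq nat_le_linear)
  qed
  have special: "inv_into A \<phi> (\<phi> a) = a" if "a \<in> A" for a
    using \<phi>(1) that by simp
  have S_special: "S (\<phi> a) = insert a (pt (\<phi> a) ` core (\<phi> a))" if "a \<in> A" for a
    using that by (auto simp: S_def special)
  have S_A: "S j \<inter> A = (if j \<in> \<phi> ` A then {inv_into A \<phi> j} else {})" for j
    using pt_B b(2) by (auto simp: S_def inv_into_into)
  have card_core: "card (core j) = r j - 1" if "j < m" for j
    using r[OF that] d[of j] by (auto simp: core_def)
  show ?thesis
  proof
    fix j assume j: "j < m"
    show "S j \<subseteq> A \<union> b ` {..<n}"
      using pt_B by (auto simp: S_def inv_into_into)
    show "card (S j) = r j"
    proof (cases "j \<in> \<phi> ` A")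
      case True
      have "card (pt j ` core j) = r j - 1"
        using card_core[OF j] bound(1)[OF j] pt_inj[of j]
        by (subst card_image) (auto simp: inj_on_def)
      moreover have "inv_into A \<phi> j \<notin> pt j ` core j"
      proof
        assume "inv_into A \<phi> j \<in> pt j ` core j"
        then obtain x where "inv_into A \<phi> j = pt j x" by blast
        then show False using pt_B[of j x] inv_into_into[OF True] b(2) by auto
      qed
      moreover have "finite (pt j ` core j)" by (simp add: core_def)
      ultimately show ?thesis using True r[OF j] by (simp add: S_def)
    next
      case False
      have "card (S j) = card (insert (d j + (r j - 2)) (core j))"
        using False bound(1)[OF j] pt_inj[of j]
        unfolding S_def by (simp only: if_False, intro card_image) (auto simp: inj_on_def)
      also have "\<dots> = Suc (card (core j))"
        using d[of j] by (subst card_insert_disjoint) (auto simp: core_def)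
      finally show ?thesis using card_core[OF j] r[OF j] by simp
    qed
    have "b (cell j) = pt j 0" using cell_less[OF j] by (simp add: pt_def)
    then show "b (cell j) \<in> S j" by (auto simp: S_def core_def)
    assume cr: "crossing j" and le: "Suc (cell j) < n"
    have "b (Suc (cell j)) = pt j 1" using le by (simp add: pt_def)
    moreover have "1 \<in> core j" if "3 \<le> r j" using that cr by (simp add: core_def d_def)
    moreover have "1 = d j + (r j - 2)" if "\<not> 3 \<le> r j" using that cr r[OF j] by (simp add: d_def)
    moreover have "3 \<le> r j" if "j \<in> \<phi> ` A" using that \<phi>(2) cr by auto
    ultimately show "b (Suc (cell j)) \<in> S j" unfolding S_def by (metis image_eqI insertCI)
  next
    show "A \<subseteq> (\<Union>j<m. S j)"
      using \<phi>(2) S_special by fastforce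
    show "inj_on S {..<m}"
    proof (rule inj_onI)
      fix j k assume jk: "j \<in> {..<m}" "k \<in> {..<m}" and eq: "S j = S k"
      show "j = k"
      proof (cases "j \<in> \<phi> ` A")
        \<comment> \<open>The point of \<open>A\<close> in an edge determines its index, because
          \<phi> is a function on \<open>A\<close>.\<close>
        case True
        then have "k \<in> \<phi> ` A" "inv_into A \<phi> j = inv_into A \<phi> k"
          using S_A[of j] S_A[of k] eq by (auto split: if_splits)
        then show ?thesis using True by (metis f_inv_into_f)
      next
        case False
        then have k: "k \<notin> \<phi> ` A" using S_A[of j] S_A[of k] eq by (auto split: if_splits)
        let ?I = "\<lambda>j. insert (d j + (r j - 2)) (core j)"
        have I: "pt j ` ?I j = pt k ` ?I k" using eq False k by (simp add: S_def)
        have mem0: "0 \<in> ?I i" for i by (simp add: core_def)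
        obtain x where x: "x \<in> ?I k" "pt j 0 = pt k x" using I mem0 by blast
        obtain y where y: "y \<in> ?I j" "pt k 0 = pt j y" using I mem0 by blast
        \<comment> \<open>Going from \<open>cell j\<close> to \<open>cell k\<close> by the offset
          \<open>y\<close> and back by \<open>x\<close> closes up modulo \<open>n\<close>; as
          \<open>x + y < n\<close>, both offsets vanish.\<close>
        have "pt j (x + y) = pt j 0"
        proof -
          have "(cell j + (x + y)) mod n = ((cell j + y) mod n + x) mod n"
            by (metis add.assoc add.commute mod_add_left_eq)
          also have "(cell j + y) mod n = cell k mod n" using y(2) by (simp add: pt_eq)
          also have "(cell k mod n + x) mod n = cell j mod n"
            using x(2) by (simp add: pt_eq mod_add_left_eq)
          finally show ?thesis by (simp add: pt_eq)
        qed
        then have "x + y = 0"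
          using pt_inj[of j "x + y" 0] bound(2)[of k x] bound(2)[of j y] x y jk by simp
        then have "x = 0" by simp
        then have cell: "cell j = cell k" using x(2) cell_less jk by (simp add: pt_eq)
        then have pt: "pt j = pt k" by (simp add: pt_def fun_eq_iff)
        have "?I j = ?I k"
        proof (rule inj_on_image_eq_iff[THEN iffD1])
          show "inj_on (pt k) {..<n}" using pt_inj by (auto simp: inj_on_def)
          show "?I j \<subseteq> {..<n}" "?I k \<subseteq> {..<n}" using bound(1) jk by (auto simp del: insert_iff)
          show "pt k ` ?I j = pt k ` ?I k" using I pt by simp
        qed
        \<comment> \<open>\<open>d i\<close> is the least nonzero offset of edge \<open>i\<close>,
          so equal offset sets have equal \<open>d\<close>.\<close>
        moreover have "d i \<in> ?I i" for i
          by (cases "r i - 2") (auto simp: core_def)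
        moreover have "d i \<le> x" if "x \<in> ?I i" "x \<noteq> 0" for i x
          using that by (auto simp: core_def)
        ultimately have dd: "d j = d k" using d by (metis le_antisym not_one_le_zero)
        show ?thesis
        proof (cases "crossing j")
          case True
          then have "crossing k" using dd by (auto simp: d_def split: if_splits)
          then show ?thesis using crossing_unique[of j k] True jk cell by simp
        next
          case False
          then have "\<not> crossing k" using dd by (auto simp: d_def split: if_splits)
          then have md: "j mod K = k mod K" using False dd by (simp add: d_def)
          have "i = l" if "i \<le> l" "i < m" "l < m" "cell i = cell l" "i mod K = l mod K" for i l
          proof (rule ccontr)
            assume "i \<noteq> l"
            moreover have "K dvd l - i" using that by (metis mod_eq_dvd_iff_nat)
            ultimately have "K \<le> l - i" using that by (simp add: dvd_imp_le)
            then have "real K * \<omega> \<le> real (l - i) * \<omega>"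
              using eta_pos eta_le by (intro mult_right_mono) auto
            then show False using same_cell_close[of i l] that K by linarith
          qed
          then show ?thesis using md cell jk by (metis lessThan_iff nat_le_linear)
        qed
      qed
    qed
  qed
qed

end

section \<open>The extension of a structure by a weight line\<close>

lemma induced_induced: "Y \<subseteq> X \<Longrightarrow> induced (induced D X) Y = induced D Y"
  by (auto simp: induced_def)

lemma delta_induced:
  "delta L alpha (induced D X) = real (card X) - (\<Sum>E\<in>L. alpha E * real (card {S \<in> snd D E. S \<subseteq> X}))"
  by (simp add: delta_def induced_def)

text \<open>The alternatives in \<open>free\<close> are two sources of edges with room for
  \<open>A\<close>: at most \<open>n\<close> edges cross, and an edge of arity at least 3 has room
  even if it crosses.\<close>

lemma essential_minimal_pair_extension:
  fixes L :: "'l set" and ar :: "'l \<Rightarrow> nat" and alpha :: "'l \<Rightarrow> real"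
    and A :: "('a, 'l) struc" and e :: "nat \<Rightarrow> 'l" and m n K R :: nat
  assumes L: "finite L" and ar: "\<forall>E\<in>L. 2 \<le> ar E \<and> ar E \<le> R"
    and UNIV: "infinite (UNIV :: 'a set)"
    and KA: "K_alpha L ar alpha A" and A_pos: "0 < delta L alpha A" and eta: "\<eta> \<le> delta L alpha A"
    and e: "\<And>j. j < m \<Longrightarrow> e j \<in> L"
    and line: "weight_line (\<lambda>j. alpha (e j)) m n \<eta> \<omega>"
    and K: "2 \<le> real K * \<omega>" and n: "2 * (K + R) < n"
    and free: "n + card (fst A) \<le> m \<or> card (fst A) \<le> card {j. j < m \<and> 3 \<le> ar (e j)}"
  shows "\<exists>D. essential_minimal_pair L ar alpha A D \<and> delta L alpha D - delta L alpha A = - \<eta>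
    \<and> card (fst D) = card (fst A) + n"
proof -
  interpret weight_line "\<lambda>j. alpha (e j)" m n \<eta> \<omega> by (fact line)
  have wfA: "wf_struc L ar A" using KA by (simp add: K_alpha_def)
  have finA: "finite (fst A)" using wfA by (simp add: wf_struc_def)
  have A_edges: "S \<subseteq> fst A" if "S \<in> snd A E" for S E
    using that wfA by (cases "E \<in> L") (auto simp: wf_struc_def)
  have fin_edges: "finite (snd A E)" for E
    using A_edges finA by (meson PowI finite_Pow_iff finite_subset subsetI)
  have "infinite (- fst A)" using finA UNIV by (metis finite_compl)
  then obtain b :: "nat \<Rightarrow> 'a" where b: "inj b" "range b \<subseteq> - fst A"
    using infinite_countable_subset by blast
  let ?B = "b ` {..<n}"
  have bn: "inj_on b {..<n}" using b(1) by (rule inj_on_subset) auto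
  have disj: "?B \<inter> fst A = {}" using b(2) by auto
  have "card (fst A) \<le> card {j. j < m \<and> (\<not> crossing j \<or> 3 \<le> ar (e j))}"
    using free
  proof
    assume "n + card (fst A) \<le> m"
    then have "card (fst A) \<le> card {j. j < m \<and> \<not> crossing j}" using card_not_crossing by linarith
    also have "\<dots> \<le> card {j. j < m \<and> (\<not> crossing j \<or> 3 \<le> ar (e j))}" by (intro card_mono) auto
    finally show ?thesis .
  next
    assume "card (fst A) \<le> card {j. j < m \<and> 3 \<le> ar (e j)}"
    also have "\<dots> \<le> card {j. j < m \<and> (\<not> crossing j \<or> 3 \<le> ar (e j))}" by (intro card_mono) auto
    finally show ?thesis .
  qed
  then obtain S where S_sub: "\<And>j. j < m \<Longrightarrow> S j \<subseteq> fst A \<union> ?B"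
    and S_card: "\<And>j. j < m \<Longrightarrow> card (S j) = ar (e j)"
    and S_cell: "\<And>j. j < m \<Longrightarrow> b (cell j) \<in> S j"
    and S_cross: "\<And>j. j < m \<Longrightarrow> crossing j \<Longrightarrow> Suc (cell j) < n \<Longrightarrow> b (Suc (cell j)) \<in> S j"
    and S_inj: "inj_on S {..<m}" and S_cover: "fst A \<subseteq> (\<Union>j<m. S j)"
    using ex_distinct_edges[OF bn disj finA, of "\<lambda>j. ar (e j)" R K] ar e K n by (smt (verit, best))
  define D where "D = (fst A \<union> ?B, \<lambda>E. snd A E \<union> {S j | j. j < m \<and> e j = E})"
  have fstD: "fst D = fst A \<union> ?B" by (simp add: D_def)
  have S_notA: "\<not> S j \<subseteq> fst A" if "j < m" for j
    using S_cell[OF that] cell_less[OF that] disj by auto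
  have wfD: "wf_struc L ar D"
    unfolding wf_struc_def
  proof (intro conjI allI impI)
    show "finite (fst D)" using finA by (simp add: fstD)
    show "snd D E = {}" if "E \<notin> L" for E
      using that e wfA by (auto simp: D_def wf_struc_def)
    show "snd D E \<subseteq> {S. S \<subseteq> fst D \<and> card S = ar E}" if "E \<in> L" for E
    proof -
      have "snd A E \<subseteq> {S. S \<subseteq> fst D \<and> card S = ar E}"
        using that wfA unfolding wf_struc_def fstD by blast
      then show ?thesis using S_sub S_card by (auto simp: D_def)
    qed
  qed
  have A_sub: "A = induced D (fst A)"
    using S_notA A_edges by (auto simp: induced_def D_def prod_eq_iff fun_eq_iff)
  \<comment> \<open>Every new edge contains a new point, so relative to
    \<open>X \<inter> fst A\<close> only the new points and the new edges inside \<open>X\<close>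
    count.\<close>
  have rel: "delta L alpha (induced D X) - delta L alpha (induced D (X \<inter> fst A))
      = real (card (X \<inter> ?B)) - (\<Sum>j | j < m \<and> S j \<subseteq> X. alpha (e j))" if X: "X \<subseteq> fst D" for X
  proof -
    let ?J = "{j. j < m \<and> S j \<subseteq> X}"
    have finX: "finite X" using X finA by (auto simp: fstD intro: finite_subset)
    have cX: "card X = card (X \<inter> fst A) + card (X \<inter> ?B)"
      using X finX disj by (subst card_Un_disjoint[symmetric]) (auto simp: fstD intro!: arg_cong[of _ _ card])
    have edges: "card {T \<in> snd D E. T \<subseteq> X} = card {T \<in> snd D E. T \<subseteq> X \<inter> fst A} + card {j \<in> ?J. e j = E}" for E
    proof -
      have 1: "{T \<in> snd D E. T \<subseteq> X} = {T \<in> snd D E. T \<subseteq> X \<inter> fst A} \<union> S ` {j \<in> ?J. e j = E}"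
        using A_edges by (auto simp: D_def)
      have 2: "{T \<in> snd D E. T \<subseteq> X \<inter> fst A} \<subseteq> snd A E"
        using S_notA by (auto simp: D_def)
      have 3: "{T \<in> snd D E. T \<subseteq> X \<inter> fst A} \<inter> S ` {j \<in> ?J. e j = E} = {}"
        using S_notA by auto
      have 4: "card (S ` {j \<in> ?J. e j = E}) = card {j \<in> ?J. e j = E}"
        by (intro card_image inj_on_subset[OF S_inj]) auto
      show ?thesis
        unfolding 1 using 3 4 finite_subset[OF 2 fin_edges] by (subst card_Un_disjoint) auto
    qed
    have "(\<Sum>E\<in>L. alpha E * real (card {j \<in> ?J. e j = E})) = (\<Sum>E\<in>L. \<Sum>j\<in>{j \<in> ?J. e j = E}. alpha (e j))"
      by (intro sum.cong) auto
    also have "\<dots> = (\<Sum>j\<in>?J. alpha (e j))"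
      using L e by (intro sum.group) auto
    finally show ?thesis
      by (simp add: delta_induced cX edges algebra_simps sum.distrib)
  qed
  have D_ind: "induced D (fst D) = D"
    using wfD by (fastforce simp: induced_def prod_eq_iff fun_eq_iff wf_struc_def)
  have dD: "delta L alpha D - delta L alpha A = - \<eta>"
  proof -
    have "fst D \<inter> fst A = fst A" "fst D \<inter> ?B = ?B" "{j. j < m \<and> S j \<subseteq> fst D} = {..<m}"
      using S_sub by (auto simp: fstD)
    then show ?thesis
      using rel[of "fst D"] D_ind A_sub[symmetric] total bn by (simp add: card_image)
  qed
  have ess: "0 \<le> delta L alpha (induced D X) - delta L alpha (induced D (X \<inter> fst A))"
    if X: "X \<subset> fst D" for X
    using weight_of_subset[OF bn S_cell S_cross S_cover, of X] rel[of X] X by (auto simp: fstD)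
  have KD: "K_alpha L ar alpha D"
    unfolding K_alpha_def
  proof (intro conjI wfD allI impI)
    fix X assume X: "X \<subseteq> fst D"
    show "0 \<le> delta L alpha (induced D X)"
    proof (cases "X = fst D")
      \<comment> \<open>The full universe is not covered by \<open>ess\<close>; there the loss of
        \<eta> is affordable by \<open>eta\<close>.\<close>
      case True
      then show ?thesis using D_ind dD eta by simp
    next
      case False
      have "induced D (X \<inter> fst A) = induced A (X \<inter> fst A)"
        by (subst A_sub) (simp add: induced_induced)
      then have "0 \<le> delta L alpha (induced D (X \<inter> fst A))" using KA by (simp add: K_alpha_def)
      moreover have "X \<subset> fst D" using False X by auto
      ultimately show ?thesis using ess[of X] by linarith
    qed
  qed
  have "minimal_pair L alpha A D"
    unfolding minimal_pair_def
  proof (intro conjI allI impI)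
    show "substr A D" using A_sub unfolding substr_def fstD by blast
    show "\<not> le_str L alpha A D"
      using dD eta_pos D_ind by (auto simp: le_str_def fstD)
    fix X assume X: "fst A \<subseteq> X \<and> X \<subset> fst D"
    show "le_str L alpha A (induced D X)"
      unfolding le_str_def
    proof (intro conjI allI impI)
      show "substr A (induced D X)"
        using X A_sub[symmetric] by (simp add: substr_def induced_induced) (simp add: induced_def)
      fix Y assume "fst A \<subseteq> Y \<and> Y \<subseteq> fst (induced D X)"
      then have Y: "fst A \<subseteq> Y" "Y \<subseteq> X" by (auto simp: induced_def)
      then have "Y \<inter> fst A = fst A" "Y \<subset> fst D" using X by auto
      then show "delta L alpha A \<le> delta L alpha (induced (induced D X) Y)"
        using ess[of Y] A_sub[symmetric] Y by (simp add: induced_induced)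
    qed
  qed
  then have "essential_minimal_pair L ar alpha A D"
    using KA A_pos KD ess by (simp add: essential_minimal_pair_def)
  moreover have "card (fst D) = card (fst A) + n"
    using finA disj bn by (simp add: fstD card_Un_disjoint Int_commute card_image)
  ultimately show ?thesis using dD by blast
qed

section \<open>From unbounded cardinalities to infinitely many isomorphism types\<close>

text \<open>One structure is chosen for each attained cardinality, and isomorphic structures have
  equal cardinality.\<close>

lemma ex_infinite_nonisomorphic:
  assumes "\<And>N. \<exists>D. P D \<and> N \<le> card (fst D)"
  shows "\<exists>\<D>. infinite \<D> \<and> (\<forall>D\<in>\<D>. P D) \<and> (\<forall>D1\<in>\<D>. \<forall>D2\<in>\<D>. D1 \<noteq> D2 \<longrightarrow> \<not> isomorphic L D1 D2)"
proof -
  define C where "C = {card (fst D) | D. P D}"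
  define pick where "pick k = (SOME D. P D \<and> card (fst D) = k)" for k
  have pick: "P (pick k) \<and> card (fst (pick k)) = k" if "k \<in> C" for k
  proof -
    have "\<exists>D. P D \<and> card (fst D) = k" using that unfolding C_def by blast
    then show ?thesis unfolding pick_def by (rule someI_ex)
  qed
  have "infinite C"
  proof
    assume "finite C"
    then obtain N where N: "\<forall>k\<in>C. k < N" using finite_nat_set_iff_bounded by blast
    obtain D where "P D" "N \<le> card (fst D)" using assms by blast
    then have "card (fst D) \<in> C" unfolding C_def by blast
    then show False using N \<open>N \<le> card (fst D)\<close> by (meson not_le)
  qed
  moreover have "inj_on pick C" by (rule inj_on_inverseI[where g = "\<lambda>D. card (fst D)"]) (simp add: pick)
  ultimately have "infinite (pick ` C)" by (simp add: finite_image_iff)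
  moreover have "D1 = D2" if "D1 \<in> pick ` C" "D2 \<in> pick ` C" "isomorphic L D1 D2" for D1 D2
  proof -
    have "card (fst D1) = card (fst D2)"
      using that(3) by (auto simp: isomorphic_def dest: bij_betw_same_card)
    then show ?thesis using that(1,2) pick by auto
  qed
  ultimately show ?thesis using pick by blast
qed

section \<open>Irrational weights\<close>

text \<open>The least positive \<open>m\<close> whose fractional part falls below a threshold is
  automatically a record. A threshold no larger than the first \<open>N\<close> fractional parts
  forces \<open>N < m\<close>.\<close>

lemma frac_mult_record:
  fixes x \<epsilon> :: real and N :: nat
  assumes x: "x \<notin> \<rat>" and \<epsilon>: "0 < \<epsilon>"
  obtains m where "N < m" "0 < frac (real m * x)" "frac (real m * x) < \<epsilon>"
    "\<And>j. 0 < j \<Longrightarrow> j < m \<Longrightarrow> frac (real m * x) \<le> frac (real j * x)"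
proof -
  have pos: "0 < frac (real j * x)" if "0 < j" for j
  proof -
    have "real j * x \<notin> \<int>"
    proof
      assume "real j * x \<in> \<int>"
      then have "real j * x / real j \<in> \<rat>" using Ints_subset_Rats by (intro Rats_divide) auto
      then show False using x that by simp
    qed
    then show ?thesis by (simp add: frac_gt_0_iff)
  qed
  define \<epsilon>' where "\<epsilon>' = Min (insert \<epsilon> ((\<lambda>j. frac (real j * x)) ` {1..N}))"
  have \<epsilon>': "0 < \<epsilon>'" "\<epsilon>' \<le> \<epsilon>" using \<epsilon> pos by (auto simp: \<epsilon>'_def)
  have le: "\<epsilon>' \<le> frac (real j * x)" if "0 < j" "j \<le> N" for j
    unfolding \<epsilon>'_def using that by (intro Min_le) auto
  let ?P = "\<lambda>m. 0 < m \<and> frac (real m * x) < \<epsilon>'"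
  obtain k where "?P k" using Kronecker_approx_1_explicit[OF x, of 0 \<epsilon>'] \<epsilon>'(1) by auto
  then have P: "?P (LEAST m. ?P m)" by (rule LeastI)
  show ?thesis
  proof
    show "0 < frac (real (LEAST m. ?P m) * x)" using P pos by blast
    show "frac (real (LEAST m. ?P m) * x) < \<epsilon>" using P \<epsilon>'(2) by linarith
    show "N < (LEAST m. ?P m)" using P le[of "LEAST m. ?P m"] by linarith
    show "frac (real (LEAST m. ?P m) * x) \<le> frac (real j * x)" if "0 < j" "j < (LEAST m. ?P m)" for j
      using not_less_Least[OF that(2)] that(1) P by linarith
  qed
qed

lemma irrational_extensions:
  fixes L :: "'l set" and ar :: "'l \<Rightarrow> nat" and alpha :: "'l \<Rightarrow> real" and A :: "('a, 'l) struc"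
  assumes L: "finite L" and ar: "\<forall>E\<in>L. ar E \<ge> 2" and alpha: "\<forall>E\<in>L. 0 < alpha E \<and> alpha E \<le> 1"
    and UNIV: "infinite (UNIV :: 'a set)"
    and A: "K_alpha L ar alpha A" "delta L alpha A > 0"
    and irrational: "\<not> rational_weights L alpha" and \<epsilon>: "0 < \<epsilon>"
  shows "\<exists>D. (essential_minimal_pair L ar alpha A D \<and> - \<epsilon> < delta L alpha D - delta L alpha A \<and>
    delta L alpha D - delta L alpha A < 0) \<and> N \<le> card (fst D)"
proof -
  obtain E where E: "E \<in> L" "alpha E \<notin> \<rat>" using irrational by (auto simp: rational_weights_def)
  define x where "x = alpha E"
  have x: "x \<notin> \<rat>" "0 < x" "x < 1"
    using E alpha by (auto simp: x_def less_le)
  define R where "R = (\<Sum>E\<in>L. ar E)"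
  have ar': "\<forall>E\<in>L. 2 \<le> ar E \<and> ar E \<le> R"
    using ar L by (auto simp: R_def intro: member_le_sum)
  obtain K :: nat where K: "2 \<le> real K * x"
    using reals_Archimedean3[OF x(2), rule_format, of 2] by (auto intro: less_imp_le)
  \<comment> \<open>\<open>M1\<close> makes \<open>n\<close> large, the summand 1 covering the loss
    in the floor; \<open>M2\<close> makes \<open>m\<close> exceed \<open>n\<close> by at least the
    size of \<open>A\<close>.\<close>
  obtain M1 :: nat where M1: "real (2 * (K + R) + N + 1) \<le> real M1 * x"
    using reals_Archimedean3[OF x(2), rule_format, of "real (2 * (K + R) + N + 1)"] by (auto intro: less_imp_le)
  obtain M2 :: nat where M2: "real (card (fst A)) \<le> real M2 * (1 - x)"
    using reals_Archimedean3[of "1 - x", rule_format, of "real (card (fst A))"] x by (auto intro: less_imp_le)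
  \<comment> \<open>The bound by \<open>x\<close> serves \<open>eta_le\<close> with \<omega> =
    \<open>x\<close>; the bound by the predimension of \<open>A\<close> keeps that of the extension
    nonnegative.\<close>
  obtain m where m: "max M1 M2 < m" and \<eta>: "0 < frac (real m * x)"
      "frac (real m * x) < min \<epsilon> (min x (delta L alpha A))"
    and least: "\<And>j. 0 < j \<Longrightarrow> j < m \<Longrightarrow> frac (real m * x) \<le> frac (real j * x)"
    using frac_mult_record[OF x(1), of "min \<epsilon> (min x (delta L alpha A))" "max M1 M2"] \<epsilon> x A(2) by auto
  define n where "n = nat \<lfloor>real m * x\<rfloor>"
  have total: "real m * x = real n + frac (real m * x)"
    using x by (simp add: n_def frac_def)
  have "real M1 * x \<le> real m * x" using m x by (intro mult_right_mono) auto
  then have "real (2 * (K + R) + N) < real n" using M1 total frac_lt_1[of "real m * x"] by simp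
  then have n: "2 * (K + R) + N < n" by (simp only: of_nat_less_iff)
  have "real M2 * (1 - x) \<le> real m * (1 - x)" using m x by (intro mult_right_mono) auto
  then have "real (n + card (fst A)) \<le> real m" 
    using M2 total frac_ge_0[of "real m * x"] unfolding right_diff_distrib of_nat_add by linarith
  then have free: "n + card (fst A) \<le> m" by (simp only: of_nat_le_iff)
  have "weight_line (\<lambda>j. alpha E) m n (frac (real m * x)) x"
  proof
    fix j i :: nat assume "j < m" "1 \<le> i" and less: "real i < (\<Sum>k<j. alpha E)"
    then have i: "real i < real j * x" by (simp add: x_def)
    then have "0 < j" by (cases j) auto
    \<comment> \<open>The partial sums are the multiples of \<open>x\<close>, so the record property
      yields \<open>gap\<close>.\<close>
    then have "frac (real m * x) \<le> frac (real j * x)" using least \<open>j < m\<close> by blast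
    moreover have "int i \<le> \<lfloor>real j * x\<rfloor>" using i by (simp add: le_floor_iff)
    then have "real i \<le> of_int \<lfloor>real j * x\<rfloor>" by linarith
    moreover have "(\<Sum>k<j. alpha E) = of_int \<lfloor>real j * x\<rfloor> + frac (real j * x)"
      by (simp add: frac_def x_def)
    ultimately show "real i + frac (real m * x) \<le> (\<Sum>k<j. alpha E)" by linarith
  qed (use \<eta> x n total in \<open>auto simp: x_def[symmetric]\<close>)
  then have "\<exists>D. essential_minimal_pair L ar alpha A D
      \<and> delta L alpha D - delta L alpha A = - frac (real m * x) \<and> card (fst D) = card (fst A) + n"
    using \<eta> n K free E(1)
    by (intro essential_minimal_pair_extension[OF L ar' UNIV A]) auto
  then show ?thesis using \<eta> n by fastforce
qed

section \<open>Rational weights\<close>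

lemma Rats_real_denom:
  assumes "x \<in> \<rat>"
  obtains p where "x = of_int p / of_int (real_denom x)" "coprime p (real_denom x)" "0 < real_denom x"
proof -
  obtain q where q: "x = of_rat q" using assms by (auto elim: Rats_cases)
  then have THE: "(THE r. of_rat r = x) = q" by auto
  obtain p d where pd: "quotient_of q = (p, d)" by fastforce
  then have d: "real_denom x = d" by (simp add: real_denom_def THE)
  have "x = of_int p / of_int d"
    using quotient_of_div[OF pd] by (simp add: q of_rat_divide)
  then show ?thesis
    using quotient_of_coprime[OF pd] quotient_of_denom_pos[OF pd] unfolding d[symmetric] by (rule that[of p])
qed

text \<open>If \<open>g\<close> divides \<open>c\<close> and all numerators \<open>a E\<close>, then
  coprimality of \<open>p E\<close> and \<open>q E\<close> makes each \<open>q E\<close> divide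
  \<open>c div g\<close>; so the least common multiple \<open>c\<close> divides
  \<open>c div g\<close>, and \<open>g = 1\<close>. This is what allows Bezout to reach the excess
  1/c.\<close>

lemma common_denominator:
  assumes L: "finite L" and rat: "rational_weights L alpha"
  obtains a :: "'l \<Rightarrow> int" where "0 < lcm_denoms L alpha"
    "\<And>E. E \<in> L \<Longrightarrow> alpha E = of_int (a E) / of_int (lcm_denoms L alpha)"
    "gcd (lcm_denoms L alpha) (Gcd (a ` L)) = 1"
proof -
  define q where "q E = real_denom (alpha E)" for E
  define c where "c = lcm_denoms L alpha"
  have "\<forall>E\<in>L. \<exists>p. alpha E = of_int p / of_int (q E) \<and> coprime p (q E) \<and> 0 < q E"
    using rat Rats_real_denom unfolding rational_weights_def q_def by metis
  then obtain p where p: "\<And>E. E \<in> L \<Longrightarrow> alpha E = of_int (p E) / of_int (q E)"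
      "\<And>E. E \<in> L \<Longrightarrow> coprime (p E) (q E)" "\<And>E. E \<in> L \<Longrightarrow> 0 < q E"
    by metis
  have c_Lcm: "c = Lcm (q ` L)" by (simp add: c_def lcm_denoms_def q_def)
  have "c \<noteq> 0"
    unfolding c_Lcm using L p(3) by (subst Lcm_0_iff) force+
  then have c: "0 < c" using Lcm_int_greater_eq_0[of "q ` L"] unfolding c_Lcm by linarith
  have qc: "q E dvd c" if "E \<in> L" for E using that by (simp add: c_Lcm)
  define a where "a E = p E * (c div q E)" for E
  have aq: "a E * q E = p E * c" if "E \<in> L" for E
    using qc[OF that] by (simp add: a_def)
  have "alpha E = of_int (a E) / of_int c" if "E \<in> L" for E
  proof -
    have "real_of_int (a E) * of_int (q E) = of_int (p E) * of_int c"
      using aq[OF that] by (metis of_int_mult)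
    then show ?thesis unfolding p(1)[OF that] using c p(3)[OF that] by (simp add: frac_eq_eq mult.commute)
  qed
  moreover have "gcd c (Gcd (a ` L)) = 1"
  proof -
    define g where "g = gcd c (Gcd (a ` L))"
    have g: "g dvd c" "g \<noteq> 0" using c by (auto simp: g_def)
    have "q E dvd c div g" if E: "E \<in> L" for E
    proof -
      have "Gcd (a ` L) dvd a E" using E by (intro Gcd_dvd) auto
      then have ga: "g dvd a E" unfolding g_def by (meson dvd_trans gcd_dvd2)
      have "g * (a E div g * q E) = g * (p E * (c div g))"
        using aq[OF E] g ga by (metis dvd_mult_div_cancel mult.assoc mult.left_commute)
      then have "q E dvd p E * (c div g)" using g(2) by (metis dvd_triv_right mult_left_cancel)
      then show ?thesis using p(2)[OF E] by (simp add: coprime_commute coprime_dvd_mult_right_iff)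
    qed
    then have "c dvd c div g" unfolding c_Lcm[symmetric] by (subst c_Lcm) (auto intro: Lcm_least)
    moreover have "0 < c div g" using c g by (metis dvd_div_eq_0_iff g_def gcd_ge_0_int less_le pos_imp_zdiv_nonneg_iff)
    ultimately have "c \<le> c div g" by (simp add: zdvd_imp_le)
    moreover have "0 < g" using g(2) by (simp add: g_def less_le)
    ultimately have "g = 1" using c int_div_less_self[of c g] by linarith
    then show ?thesis by (simp add: g_def)
  qed
  ultimately show ?thesis using that c by (simp add: c_def)
qed

lemma ex_Gcd_combination:
  fixes a :: "'l \<Rightarrow> int"
  assumes "finite L"
  shows "\<exists>u. (\<Sum>E\<in>L. u E * a E) = Gcd (a ` L)"
  using assms
proof induction
  case (insert E L)
  then obtain u where u: "(\<Sum>E\<in>L. u E * a E) = Gcd (a ` L)" by blast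
  obtain s t where st: "s * a E + t * Gcd (a ` L) = gcd (a E) (Gcd (a ` L))" using bezout_int by blast
  have "(\<Sum>F\<in>L. (if F = E then s else t * u F) * a F) = (\<Sum>F\<in>L. t * (u F * a F))"
    using insert.hyps by (intro sum.cong) auto
  also have "\<dots> = t * Gcd (a ` L)" by (simp add: u flip: sum_distrib_left)
  finally have "(\<Sum>F\<in>insert E L. (if F = E then s else t * u F) * a F) = Gcd (a ` insert E L)"
    using insert.hyps st by simp
  then show ?case by (intro exI)
qed simp

text \<open>Turns multiplicities into a sequence of symbols, as the edges must be laid out in some
  order.\<close>

lemma ex_list_multiplicities:
  fixes f :: "'l \<Rightarrow> int" and k :: "'l \<Rightarrow> nat"
  assumes "finite L"
  shows "\<exists>xs. set xs \<subseteq> L \<and> sum_list (map f xs) = (\<Sum>E\<in>L. int (k E) * f E)"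
  using assms
proof induction
  case (insert E L)
  then obtain xs where "set xs \<subseteq> L" "sum_list (map f xs) = (\<Sum>E\<in>L. int (k E) * f E)" by blast
  then show ?case using insert.hyps
    by (intro exI[of _ "replicate (k E) E @ xs"]) (auto simp: sum_list_replicate)
qed simp

text \<open>Bezout gives a sequence of symbols whose total weight is an integer plus 1/c. Appending
  copies of one symbol \<open>E\<close> in blocks of \<open>c\<close> adds integer weight and makes
  \<open>n\<close> as large as required.\<close>

lemma rational_extensions:
  fixes L :: "'l set" and ar :: "'l \<Rightarrow> nat" and alpha :: "'l \<Rightarrow> real" and A :: "('a, 'l) struc"
  assumes L: "finite L" and ar: "\<forall>E\<in>L. ar E \<ge> 2" and alpha: "\<forall>E\<in>L. 0 < alpha E \<and> alpha E \<le> 1"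
    and nontrivial: "\<not> (\<forall>E\<in>L. ar E = 2 \<and> alpha E = 1)"
    and UNIV: "infinite (UNIV :: 'a set)"
    and A: "K_alpha L ar alpha A" "delta L alpha A > 0"
    and rat: "rational_weights L alpha"
  shows "\<exists>D. (essential_minimal_pair L ar alpha A D \<and>
    delta L alpha D - delta L alpha A = - 1 / real_of_int (lcm_denoms L alpha)) \<and> N \<le> card (fst D)"
proof -
  define c where "c = lcm_denoms L alpha"
  obtain a where c: "0 < c" and a: "\<And>E. E \<in> L \<Longrightarrow> alpha E = of_int (a E) / of_int c"
    and gcd: "gcd c (Gcd (a ` L)) = 1"
    using common_denominator[OF L rat] unfolding c_def by metis
  have a_bounds: "1 \<le> a E" "a E \<le> c" if "E \<in> L" for E
  proof -
    have "0 < real_of_int (a E)" "real_of_int (a E) \<le> real_of_int c"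
      using alpha[rule_format, OF that] c unfolding a[OF that] by (auto simp: zero_less_divide_iff divide_le_eq)
    then show "1 \<le> a E" "a E \<le> c" by linarith+
  qed
  define R where "R = (\<Sum>E\<in>L. ar E)"
  have ar': "\<forall>E\<in>L. 2 \<le> ar E \<and> ar E \<le> R"
    using ar L by (auto simp: R_def intro: member_le_sum)
  \<comment> \<open>Copies of \<open>E\<close> supply the room for \<open>A\<close>: either their
    arity is at least 3, or their weight is below 1 and \<open>m\<close> outgrows
    \<open>n\<close>.\<close>
  obtain E where E: "E \<in> L" "3 \<le> ar E \<or> alpha E < 1"
    using nontrivial ar alpha by (metis antisym_conv2 le_antisym not_less_eq_eq numeral_2_eq_2 numeral_3_eq_3)
  obtain xs z where xs: "set xs \<subseteq> L" and z: "sum_list (map a xs) = c * z + 1"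
  proof -
    obtain u where u: "(\<Sum>E\<in>L. u E * a E) = Gcd (a ` L)" using ex_Gcd_combination[OF L] by blast
    obtain s t where "s * c + t * Gcd (a ` L) = 1" using bezout_int[of c "Gcd (a ` L)"] gcd by auto
    then have "(\<Sum>E\<in>L. t * u E * a E) = 1 - s * c"
      by (simp add: u mult.assoc flip: sum_distrib_left)
    \<comment> \<open>Bezout coefficients may be negative; reducing them modulo \<open>c\<close>
      changes the total only by a multiple of \<open>c\<close>.\<close>
    moreover have "(\<Sum>E\<in>L. t * u E * a E) = (\<Sum>E\<in>L. (t * u E mod c) * a E) + c * (\<Sum>E\<in>L. t * u E div c * a E)"
      unfolding sum_distrib_left sum.distrib[symmetric]
      by (intro sum.cong refl) (metis add.commute distrib_right mult.assoc mult_div_mod_eq)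
    moreover obtain xs where "set xs \<subseteq> L" "sum_list (map a xs) = (\<Sum>E\<in>L. int (nat (t * u E mod c)) * a E)"
      using ex_list_multiplicities[OF L, of a "\<lambda>E. nat (t * u E mod c)"] by blast
    ultimately show ?thesis
      using c by (intro that[of xs "- s - (\<Sum>E\<in>L. t * u E div c * a E)"]) (auto simp: algebra_simps)
  qed
  \<comment> \<open>\<open>z\<close> may be negative, hence the absolute value. The other summands
    give the bound on \<open>n\<close> for \<open>K = 2 * nat c\<close>, the size \<open>N\<close>,
    and the room for \<open>A\<close>.\<close>
  define k where "k = 2 * (2 * nat c + R) + N + card (fst A) + nat \<bar>z\<bar> + 1"
  define ys where "ys = xs @ replicate (k * nat c) E"
  define m where "m = length ys"
  define e where "e j = ys ! j" for j
  have e: "e j \<in> L" if "j < m" for j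
  proof -
    have "e j \<in> set ys" using that by (simp add: e_def m_def)
    then show ?thesis using xs E(1) by (auto simp: ys_def split: if_splits)
  qed
  define n where "n = nat (z + int k * a E)"
  have kE: "int k \<le> int k * a E" using a_bounds(1)[OF E(1)] by (simp add: mult_le_cancel_left1)
  have k: "2 * (2 * c + int R) + int N + int (card (fst A)) + \<bar>z\<bar> + 1 = int k"
    using c by (simp add: k_def)
  have n: "int n = z + int k * a E" "2 * (2 * c + int R) + int N < int n"
    using kE k c by (auto simp: n_def)
  have W: "(\<Sum>i<j. alpha (e i)) = of_int (\<Sum>i<j. a (e i)) / of_int c" if "j \<le> m" for j
    using that e by (auto simp: a sum_divide_distrib intro!: sum.cong)
  have a_total: "(\<Sum>i<m. a (e i)) = c * int n + 1"
  proof -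
    have "(\<Sum>i<m. a (e i)) = sum_list (map a ys)"
      by (simp add: sum_list_sum_nth m_def e_def atLeast0LessThan)
    also have "\<dots> = c * z + 1 + int k * c * a E"
      using c by (simp add: ys_def z sum_list_replicate)
    finally show ?thesis using n(1) by (simp add: algebra_simps)
  qed
  have line: "weight_line (\<lambda>j. alpha (e j)) m n (1 / of_int c) (1 / of_int c)"
  proof
    show "(\<Sum>j<m. alpha (e j)) = real n + 1 / of_int c"
      unfolding W[OF order_refl] a_total using c by (simp add: field_simps)
    show "1 / of_int c \<le> alpha (e j)" if "j < m" for j
      using a[OF e[OF that]] a_bounds(1)[OF e[OF that]] c by (simp add: divide_right_mono)
    show "real i + 1 / of_int c \<le> (\<Sum>k<j. alpha (e k))"
      if "j < m" and less: "real i < (\<Sum>k<j. alpha (e k))" for i j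
    proof -
      let ?s = "\<Sum>k<j. a (e k)"
      \<comment> \<open>After multiplication by \<open>c\<close> both sides are integers, so a
        strict inequality leaves a gap of at least 1.\<close>
      have "real_of_int (int i * c) < of_int ?s"
        using less W[of j] that(1) c by (simp add: field_simps)
      then have "int i * c + 1 \<le> ?s" by linarith
      then have "real_of_int (int i * c + 1) \<le> of_int ?s" by (simp only: of_int_le_iff)
      then show ?thesis using W[of j] that(1) c by (simp add: field_simps)
    qed
  qed (use c alpha e n in auto)
  have free: "n + card (fst A) \<le> m \<or> card (fst A) \<le> card {j. j < m \<and> 3 \<le> ar (e j)}"
  proof (cases "3 \<le> ar E")
    case True
    have "{length xs..<m} \<subseteq> {j. j < m \<and> 3 \<le> ar (e j)}"
      using True by (auto simp: e_def m_def ys_def nth_append)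
    then have "card {length xs..<m} \<le> card {j. j < m \<and> 3 \<le> ar (e j)}" by (intro card_mono) auto
    moreover have "k \<le> k * nat c" using c by (cases "nat c") auto
    then have "card (fst A) \<le> card {length xs..<m}" by (simp add: m_def ys_def k_def)
    ultimately show ?thesis by linarith
  next
    case False
    then have "a E < c" using E a[OF E(1)] c by (simp add: field_simps)
    then have "int k * (a E + 1) \<le> int k * c" by (intro mult_left_mono) auto
    then have "int n + int (card (fst A)) \<le> int k * c" using n(1) k c by (simp add: algebra_simps)
    also have "\<dots> \<le> int m" using c by (simp add: m_def ys_def)
    finally show ?thesis by linarith
  qed
  have "1 / of_int c \<le> delta L alpha A"
  proof -
    \<comment> \<open>The predimension of \<open>A\<close> is a positive integer multiple of
      1/c.\<close>
    let ?d = "int (card (fst A)) * c - (\<Sum>E\<in>L. a E * int (card (snd A E)))"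
    have "(\<Sum>E\<in>L. alpha E * real (card (snd A E))) = (\<Sum>E\<in>L. of_int (a E) * real (card (snd A E))) / of_int c"
      by (auto simp: a sum_divide_distrib intro!: sum.cong)
    then have d: "delta L alpha A = of_int ?d / of_int c"
      using c by (simp add: delta_def field_simps)
    then have "0 < ?d" using A(2) c by (simp only: zero_less_divide_iff of_int_0_less_iff) auto
    then have "1 \<le> real_of_int ?d" by linarith
    then show ?thesis unfolding d using c by (intro divide_right_mono) auto
  qed
  then have "\<exists>D. essential_minimal_pair L ar alpha A D
      \<and> delta L alpha D - delta L alpha A = - (1 / of_int c) \<and> card (fst D) = card (fst A) + n"
    using n(2) c by (intro essential_minimal_pair_extension[OF L ar' UNIV A _ e line _ _ free, of "2 * nat c"]) auto
  then show ?thesis using n(2) c by (fastforce simp: c_def)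
qed

theorem theorem3p33:
  fixes L :: "'l set" and ar :: "'l \<Rightarrow> nat" and alpha :: "'l \<Rightarrow> real"
    and A :: "('a, 'l) struc"
  assumes "finite L"
    and "\<forall>E\<in>L. ar E \<ge> 2"
    and "\<forall>E\<in>L. 0 < alpha E \<and> alpha E \<le> 1"
    and "\<not> (\<forall>E\<in>L. ar E = 2 \<and> alpha E = 1)"
    and "infinite (UNIV :: 'a set)"
    and "K_alpha L ar alpha A"
    and "delta L alpha A > 0"
  shows "(\<not> rational_weights L alpha \<longrightarrow>
           (\<forall>\<epsilon>>0. \<exists>\<D>. infinite \<D> \<and>
              (\<forall>D\<in>\<D>. essential_minimal_pair L ar alpha A D \<and>
                 - \<epsilon> < delta L alpha D - delta L alpha A \<and>
                 delta L alpha D - delta L alpha A < 0) \<and>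
              (\<forall>D1\<in>\<D>. \<forall>D2\<in>\<D>. D1 \<noteq> D2 \<longrightarrow> \<not> isomorphic L D1 D2)))
       \<and> (rational_weights L alpha \<longrightarrow>
           (\<exists>\<D>. infinite \<D> \<and>
              (\<forall>D\<in>\<D>. essential_minimal_pair L ar alpha A D \<and>
                 delta L alpha D - delta L alpha A = - 1 / real_of_int (lcm_denoms L alpha)) \<and>
              (\<forall>D1\<in>\<D>. \<forall>D2\<in>\<D>. D1 \<noteq> D2 \<longrightarrow> \<not> isomorphic L D1 D2)))"
proof (intro conjI impI allI)
  fix \<epsilon> :: real
  assume "\<not> rational_weights L alpha" "0 < \<epsilon>"
  then show "\<exists>\<D>. infinite \<D> \<and>
      (\<forall>D\<in>\<D>. essential_minimal_pair L ar alpha A D \<and>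
         - \<epsilon> < delta L alpha D - delta L alpha A \<and> delta L alpha D - delta L alpha A < 0) \<and>
      (\<forall>D1\<in>\<D>. \<forall>D2\<in>\<D>. D1 \<noteq> D2 \<longrightarrow> \<not> isomorphic L D1 D2)"
    by (intro ex_infinite_nonisomorphic irrational_extensions[OF assms(1-3,5-7)])
next
  assume "rational_weights L alpha"
  then show "\<exists>\<D>. infinite \<D> \<and>
      (\<forall>D\<in>\<D>. essential_minimal_pair L ar alpha A D \<and>
         delta L alpha D - delta L alpha A = - 1 / real_of_int (lcm_denoms L alpha)) \<and>
      (\<forall>D1\<in>\<D>. \<forall>D2\<in>\<D>. D1 \<noteq> D2 \<longrightarrow> \<not> isomorphic L D1 D2)"
    by (intro ex_infinite_nonisomorphic rational_extensions[OF assms])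
qed

end
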